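(* Let $n\ge3$. Then any sequence $(c_1,\dots,c_n)\in\mathcal A^+$ contains a subsequence of consecutive entries $(c_k)_{i\le k\le j}$, where $1\le i\le j\le n$, of the form $$(1,1),\qquad(1,2,a),\qquad(2,1,b),\qquad(1,3,1,b)$$ or their transpose, where $1\le a\le3$ and $3\le b\le5$.
   Context: $\mathcal A^+$ is the smallest subset of $\bigcup_{n\ge2}\mathbb N_0^n$ (with $\mathbb N_0=\{0,1,2,\dots\}$) such that $(0,0)\in\mathcal A^+$ and, if $(c_1,\dots,c_n)\in\mathcal A^+$ and $1<i\le n$, then $(c_1,\dots,c_{i-2},c_{i-1}+1,1,c_i+1,c_{i+1},\dots,c_n)\in\mathcal A^+$. The transpose of a finite sequence is the sequence in reversed order. Here $a,b$ are integers. *)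

theory Defs
  imports Main "HOL-Library.Sublist"
begin

text \<open>In the step rule, \<open>a\<close> and \<open>b\<close> are the adjacent entries \<open>c\<^sub>i\<^sub>-\<^sub>1\<close> and \<open>c\<^sub>i\<close>,
  so that \<open>i = length xs + 2\<close> ranges over \<open>1 < i \<le> n\<close>.\<close>

inductive_set A_plus :: "nat list set" where
  base: "[0, 0] \<in> A_plus"
| step: "xs @ [a, b] @ ys \<in> A_plus \<Longrightarrow> xs @ [a + 1, 1, b + 1] @ ys \<in> A_plus"

end

theory Submission
  imports Defs
begin

text \<open>
  The members of \<open>\<A>\<^sup>+\<close> are the sequences counting the triangles at each vertex of a triangulated
  polygon, read off from one end of a distinguished edge to the other. Such a triangulation is a
  binary tree of triangles rooted at that edge. If the tree has height at least \<open>3\<close>, it has a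
  subtree of height exactly \<open>3\<close>; the entries at the interior vertices of that subtree are entries
  of the whole sequence, and in each of the finitely many cases they already contain one of the
  patterns. Trees of height \<open>1\<close> or \<open>2\<close> are inspected directly.
\<close>

datatype triangulation = Edge | Tri triangulation triangulation

fun left_count :: "triangulation \<Rightarrow> nat" where
  "left_count Edge = 0"
| "left_count (Tri l r) = Suc (left_count l)"

fun right_count :: "triangulation \<Rightarrow> nat" where
  "right_count Edge = 0"
| "right_count (Tri l r) = Suc (right_count r)"

fun inner_counts :: "triangulation \<Rightarrow> nat list" where
  "inner_counts Edge = []"
| "inner_counts (Tri l r) =
    inner_counts l @ [Suc (right_count l + left_count r)] @ inner_counts r"

text \<open>The offsets \<open>p\<close> and \<open>q\<close> account for the triangles outside \<open>t\<close> at the two ends of its root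
  edge; they make the counts of a subtree a contiguous block of the counts of the whole tree.\<close>

definition counts :: "nat \<Rightarrow> triangulation \<Rightarrow> nat \<Rightarrow> nat list" where
  "counts p t q = [p + left_count t] @ inner_counts t @ [right_count t + q]"

lemma counts_Tri_left:
  "counts p (Tri l r) q =
    counts (Suc p) l (Suc (left_count r)) @ inner_counts r @ [Suc (right_count r + q)]"
  by (simp add: counts_def)

lemma counts_Tri_right:
  "counts p (Tri l r) q =
    [Suc (p + left_count l)] @ inner_counts l @ counts (Suc (right_count l)) r (Suc q)"
  by (simp add: counts_def)

text \<open>The step rule glues a triangle onto the outer edge joining two adjacent vertices, that
  is, it replaces one leaf \<open>Edge\<close> by \<open>Tri Edge Edge\<close>. Arbitrary offsets
  let the induction descend into a subtree.\<close>

lemma counts_insert: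
  assumes "counts p t q = xs @ [a, b] @ ys"
  shows "\<exists>t'. counts p t' q = xs @ [a + 1, 1, b + 1] @ ys"
  using assms
proof (induction t arbitrary: p q xs ys)
  case Edge
  then have "xs = [] \<and> ys = [] \<and> a = p \<and> b = q"
    by (cases xs) (auto simp: counts_def Cons_eq_append_conv)
  then have "counts p (Tri Edge Edge) q = xs @ [a + 1, 1, b + 1] @ ys"
    by (simp add: counts_def)
  then show ?case ..
next
  case (Tri l r)
  let ?L = "counts (Suc p) l (Suc (left_count r))"
  let ?R = "counts (Suc (right_count l)) r (Suc q)"
  show ?case
  \<comment> \<open>The apex entry both ends \<open>?L\<close> and starts \<open>?R\<close>, so the
    adjacent pair \<open>a\<close>, \<open>b\<close> lies entirely in one of these blocks.\<close>
  proof (cases "length xs + 2 \<le> length ?L")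
    case True
    let ?tail = "inner_counts r @ [Suc (right_count r + q)]"
    define zs where "zs = drop (length xs + 2) ?L"
    have eq: "?L @ ?tail = (xs @ [a, b]) @ ys"
      using Tri.prems by (simp add: counts_Tri_left)
    have "take (length xs + 2) (?L @ ?tail) = xs @ [a, b]"
      unfolding eq by simp
    then have "take (length xs + 2) ?L = xs @ [a, b]"
      using True by simp
    then have L: "?L = xs @ [a, b] @ zs"
      unfolding zs_def by (metis append_assoc append_take_drop_id)
    then have ys: "ys = zs @ ?tail"
      using eq by simp
    from Tri.IH(1)[OF L] obtain l' where
      "counts (Suc p) l' (Suc (left_count r)) = xs @ [a + 1, 1, b + 1] @ zs" ..
    then have "counts p (Tri l' r) q = xs @ [a + 1, 1, b + 1] @ ys"
      by (simp add: counts_Tri_left ys)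
    then show ?thesis ..
  next
    case False
    let ?head = "[Suc (p + left_count l)] @ inner_counts l"
    define zs where "zs = drop (length ?head) xs"
    have len: "length ?head \<le> length xs"
      using False by (simp add: counts_def)
    have eq: "?head @ ?R = xs @ [a, b] @ ys"
      using Tri.prems by (simp add: counts_Tri_right)
    have "take (length ?head) (xs @ [a, b] @ ys) = ?head"
      unfolding eq[symmetric] by simp
    then have "take (length ?head) xs = ?head"
      using len by simp
    then have xs: "xs = ?head @ zs"
      unfolding zs_def by (metis append_take_drop_id)
    then have R: "?R = zs @ [a, b] @ ys"
      using eq by simp
    from Tri.IH(2)[OF R] obtain r' where
      "counts (Suc (right_count l)) r' (Suc q) = zs @ [a + 1, 1, b + 1] @ ys" ..
    then have "counts p (Tri l r') q = xs @ [a + 1, 1, b + 1] @ ys"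
      by (simp add: counts_Tri_right xs)
    then show ?thesis ..
  qed
qed

lemma A_plus_imp_counts:
  assumes "c \<in> A_plus"
  shows "\<exists>t. c = counts 0 t 0"
  using assms
proof induction
  case base
  have "[0, 0] = counts 0 Edge 0"
    by (simp add: counts_def)
  then show ?case ..
next
  case (step xs a b ys)
  then show ?case
    using counts_insert by metis
qed

definition patterns :: "nat list set" where
  "patterns = {[1, 1], [1, 2, 1], [1, 2, 2], [1, 2, 3], [2, 1, 3], [2, 1, 4], [2, 1, 5],
    [1, 3, 1, 3], [1, 3, 1, 4], [1, 3, 1, 5]}"

definition has_pattern :: "nat list \<Rightarrow> bool" where
  "has_pattern c \<longleftrightarrow> (\<exists>s \<in> patterns. sublist s c \<or> sublist (rev s) c)"

lemma has_pattern_append: "has_pattern ys \<Longrightarrow> has_pattern (xs @ ys @ zs)"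
  unfolding has_pattern_def by (meson sublist_appendI sublist_order.order_trans)

text \<open>Exactly the trees of height at most 2, with \<open>Edge\<close> of height 0.\<close>

definition small_triangulations :: "triangulation set" where
  "small_triangulations =
    (let t = Tri Edge Edge in {Edge, t, Tri t Edge, Tri Edge t, Tri t t})"

text \<open>Interior counts of a child recur unchanged in its parent, so a pattern found there
  persists.\<close>

lemma small_or_inner_pattern:
  "t \<in> small_triangulations \<or> has_pattern (inner_counts t)"
proof (induction t)
  case Edge
  show ?case by (simp add: small_triangulations_def Let_def)
next
  case (Tri l r)
  consider "has_pattern (inner_counts l)" | "has_pattern (inner_counts r)"
    | "l \<in> small_triangulations" "r \<in> small_triangulations"
    using Tri.IH by blast
  then show ?case
  proof cases
    case 1
    then show ?thesis
      using has_pattern_append[of "inner_counts l" "[]"] by simp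
  next
    case 2
    then show ?thesis
      using has_pattern_append[of "inner_counts r" "inner_counts l @ [_]" "[]"] by simp
  next
    \<comment> \<open>Of the 25 pairs of small children, 4 give a small tree; the other 21 give
      height 3 and are evaluated.\<close>
    case 3
    then show ?thesis
      unfolding small_triangulations_def Let_def
      by (elim insertE emptyE)
        (simp_all add: has_pattern_def patterns_def sublist_Cons_right numeral_eq_Suc)
  qed
qed

lemma counts_has_pattern:
  assumes "t \<noteq> Edge"
  shows "has_pattern (counts 0 t 0)"
proof (cases "t \<in> small_triangulations")
  case True
  then show ?thesis
    \<comment> \<open>The interior counts are too few here; each pattern uses an end entry.\<close>
    using assms unfolding small_triangulations_def Let_def
    by (elim insertE emptyE)
      (simp_all add: counts_def has_pattern_def patterns_def sublist_Cons_right numeral_eq_Suc)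
next
  case False
  then show ?thesis
    using small_or_inner_pattern has_pattern_append unfolding counts_def by blast
qed

theorem theorem4p6:
  fixes n :: nat and c :: "nat list"
  assumes "n \<ge> 3" and "c \<in> A_plus" and "length c = n"
  shows "\<exists>(a::nat) (b::nat) s. 1 \<le> a \<and> a \<le> 3 \<and> 3 \<le> b \<and> b \<le> 5 \<and>
           s \<in> {[1, 1], [1, 2, a], [2, 1, b], [1, 3, 1, b]} \<and>
           (sublist s c \<or> sublist (rev s) c)"
proof -
  obtain t where t: "c = counts 0 t 0"
    using A_plus_imp_counts[OF assms(2)] ..
  have "t \<noteq> Edge"
    using assms(1,3) t by (auto simp: counts_def)
  then obtain s where s: "s \<in> patterns" "sublist s c \<or> sublist (rev s) c"
    using counts_has_pattern t unfolding has_pattern_def by blast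
  \<comment> \<open>Each listed pattern determines at most one of \<open>a\<close> and
    \<open>b\<close>; the rest is free.\<close>
  have "\<exists>a \<in> {1, 2, 3}. \<exists>b \<in> {3, 4, 5}. s \<in> {[1, 1], [1, 2, a], [2, 1, b], [1, 3, 1, b]}"
    using s(1) unfolding patterns_def by (elim insertE emptyE) (simp_all, blast+)
  then obtain a b where
    "a \<in> {1, 2, 3}" "b \<in> {3, 4, 5}" "s \<in> {[1, 1], [1, 2, a], [2, 1, b], [1, 3, 1, b]}"
    by blast
  moreover from this have "1 \<le> a" "a \<le> 3" "3 \<le> b" "b \<le> 5"
    by auto
  ultimately show ?thesis
    using s(2) by blast
qed

end
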